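(* Let $\mathcal{H}$ be a separable Hilbert space, $\mathbb{I}$ a finite or countably infinite index set, $m\in\mathbb{N}$, and let $\{f_{ij}\}_{i\in\mathbb{I},j\in[m]}$ be a family of elements of $\mathcal{H}$. Then $\{f_{ij}\}_{i\in\mathbb{I},j\in[m]}$ is a Bessel woven if and only if for every partition $\sigma=\{\sigma_j\}_{j\in[m]}$ of $\mathbb{I}$ the operator $$T_{F}:\Big(\sum_{j\in[m]}\bigoplus \ell^{2}(\sigma_j)\Big)_{\ell_2}\longrightarrow\mathcal{H},\qquad T_{F}\{c_{ij}\}_{i\in\sigma_j,j\in[m]}=\sum_{j\in[m]}\sum_{i\in\sigma_j}c_{ij}f_{ij}$$ is well defined, linear and bounded.
   Context: $[m]=\{1,\dots,m\}$; Hilbert spaces are over $\mathbb{C}$. A partition $\{\sigma_j\}_{j\in[m]}$ of $\mathbb{I}$ consists of pairwise disjoint, possibly empty subsets of $\mathbb{I}$ with union $\mathbb{I}$. A sequence $\{f_i\}$ in $\mathcal{H}$ is a Bessel sequence if there is $B<\infty$ with $\sum_i|\langle f,f_i\rangle|^2\le B\|f\|^2$ for all $f\in\mathcal{H}$. The family $\{f_{ij}\}_{i\in\mathbb{I},j\in[m]}$ is a Bessel woven if for every partition $\{\sigma_j\}_{j\in[m]}$ of $\mathbb{I}$ and every $j\in[m]$ the family $\{f_{ij}\}_{i\in\sigma_j}$ is a Bessel sequence. The space $\big(\sum_{j\in[m]}\bigoplus \ell^{2}(\sigma_j)\big)_{\ell_2}$ is the Hilbert direct sum of the spaces $\ell^2(\sigma_j)$,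 $j\in[m]$, with inner product $\langle \{c_{ij}\},\{c'_{ij}\}\rangle=\sum_{j\in[m]}\sum_{i\in\sigma_j}c_{ij}\overline{c'_{ij}}$. "Well defined" means that the series converges in $\mathcal{H}$ (with respect to a fixed enumeration of $\mathbb{I}$) for every element of the domain. *)

theory Defs
  imports "HOL-Analysis.Analysis"
begin

section \<open>Complex Hilbert spaces\<close>

text \<open>
  A complex inner product space is presented as its underlying real inner product space
  together with the complex structure: the real scalar multiplication and the real inner product
  are the restriction of scalars and the real part of the complex ones. Positive definiteness and
  the norm \<open>norm x = sqrt (Re (cinner x x))\<close> are thus inherited from \<^class>\<open>real_inner\<close>.
  The inner product is linear in the first argument.
\<close>

class complex_inner = real_inner +
  fixes scaleC :: "complex \<Rightarrow> 'a \<Rightarrow> 'a" (infixr \<open>*\<^sub>C\<close> 75)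
    and cinner :: "'a \<Rightarrow> 'a \<Rightarrow> complex"
  assumes scaleC_add_right: "a *\<^sub>C (x + y) = a *\<^sub>C x + a *\<^sub>C y"
    and scaleC_add_left: "(a + b) *\<^sub>C x = a *\<^sub>C x + b *\<^sub>C x"
    and scaleC_scaleC: "a *\<^sub>C (b *\<^sub>C x) = (a * b) *\<^sub>C x"
    and scaleR_eq_scaleC: "scaleR r x = complex_of_real r *\<^sub>C x"
    and cinner_commute: "cinner x y = cnj (cinner y x)"
    and cinner_add_left: "cinner (x + y) z = cinner x z + cinner y z"
    and cinner_scaleC_left: "cinner (a *\<^sub>C x) y = a * cinner x y"
    and inner_eq_Re_cinner: "inner x y = Re (cinner x y)"
begin

lemma scaleC_one: "1 *\<^sub>C x = x"
  by (metis of_real_1 scaleR_one scaleR_eq_scaleC)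

lemma norm_eq_sqrt_Re_cinner: "norm x = sqrt (Re (cinner x x))"
  by (simp add: norm_eq_sqrt_inner inner_eq_Re_cinner)

end

class chilbert_space = complex_inner + complete_space

instantiation complex :: chilbert_space
begin

definition scaleC_complex :: "complex \<Rightarrow> complex \<Rightarrow> complex"
  where "scaleC_complex a x = a * x"

definition cinner_complex :: "complex \<Rightarrow> complex \<Rightarrow> complex"
  where "cinner_complex x y = x * cnj y"

instance
  by standard
    (simp_all add: scaleC_complex_def cinner_complex_def algebra_simps scaleR_conv_of_real
      inner_complex_def)

end

section \<open>Index sets, enumerations and partitions\<close>

text \<open>
  For finite \<open>I\<close> only the values of \<open>e\<close> below \<open>card I\<close> are constrained; the remaining values
  are junk and do not influence \<open>enum_sums e S g\<close> for \<open>S \<subseteq> I\<close>, whose partial sums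
  run over the set of indices in \<open>S\<close> enumerated so far.
\<close>

definition enumeration :: "(nat \<Rightarrow> 'i) \<Rightarrow> 'i set \<Rightarrow> bool" where
  "enumeration e I \<longleftrightarrow> bij_betw e (if finite I then {..<card I} else UNIV) I"

definition enum_sums :: "(nat \<Rightarrow> 'i) \<Rightarrow> 'i set \<Rightarrow> ('i \<Rightarrow> 'h::real_normed_vector) \<Rightarrow> nat \<Rightarrow> 'h" where
  "enum_sums e S g N = (\<Sum>i\<in>S \<inter> e ` {..<N}. g i)"

definition partition_of :: "nat \<Rightarrow> 'i set \<Rightarrow> (nat \<Rightarrow> 'i set) \<Rightarrow> bool" where
  "partition_of m I \<sigma> \<longleftrightarrow> disjoint_family_on \<sigma> {1..m} \<and> (\<Union>j\<in>{1..m}. \<sigma> j) = I"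

section \<open>Bessel sequences and Bessel wovens\<close>

definition bessel_sequence :: "'i set \<Rightarrow> ('i \<Rightarrow> 'h::complex_inner) \<Rightarrow> bool" where
  "bessel_sequence S g \<longleftrightarrow>
     (\<exists>B::real. \<forall>x. (\<lambda>i. (cmod (cinner x (g i)))\<^sup>2) summable_on S \<and>
        (\<Sum>\<^sub>\<infinity>i\<in>S. (cmod (cinner x (g i)))\<^sup>2) \<le> B * (norm x)\<^sup>2)"

definition bessel_woven :: "nat \<Rightarrow> 'i set \<Rightarrow> ('i \<Rightarrow> nat \<Rightarrow> 'h::complex_inner) \<Rightarrow> bool" where
  "bessel_woven m I f \<longleftrightarrow>
     (\<forall>\<sigma>. partition_of m I \<sigma> \<longrightarrow> (\<forall>j\<in>{1..m}. bessel_sequence (\<sigma> j) (\<lambda>i. f i j)))"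

section \<open>The direct sum of the spaces \<open>ell2 (\<sigma> j)\<close>\<close>

text \<open>
  Elements are represented as functions vanishing outside their index set, so that
  equality of elements is equality of functions.
\<close>

definition ell2 :: "'i set \<Rightarrow> ('i \<Rightarrow> complex) set" where
  "ell2 S = {c. (\<forall>i. i \<notin> S \<longrightarrow> c i = 0) \<and> (\<lambda>i. (cmod (c i))\<^sup>2) summable_on S}"

definition ell2_sum :: "nat \<Rightarrow> (nat \<Rightarrow> 'i set) \<Rightarrow> ('i \<Rightarrow> nat \<Rightarrow> complex) set" where
  "ell2_sum m \<sigma> = {c. (\<forall>j\<in>{1..m}. (\<lambda>i. c i j) \<in> ell2 (\<sigma> j)) \<and> (\<forall>i j. j \<notin> {1..m} \<longrightarrow> c i j = 0)}"

definition ell2_sum_inner ::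
  "nat \<Rightarrow> (nat \<Rightarrow> 'i set) \<Rightarrow> ('i \<Rightarrow> nat \<Rightarrow> complex) \<Rightarrow> ('i \<Rightarrow> nat \<Rightarrow> complex) \<Rightarrow> complex" where
  "ell2_sum_inner m \<sigma> c c' = (\<Sum>j\<in>{1..m}. \<Sum>\<^sub>\<infinity>i\<in>\<sigma> j. c i j * cnj (c' i j))"

definition ell2_sum_norm :: "nat \<Rightarrow> (nat \<Rightarrow> 'i set) \<Rightarrow> ('i \<Rightarrow> nat \<Rightarrow> complex) \<Rightarrow> real" where
  "ell2_sum_norm m \<sigma> c = sqrt (Re (ell2_sum_inner m \<sigma> c c))"

section \<open>The synthesis operator\<close>

definition synthesis_well_defined ::
  "(nat \<Rightarrow> 'i) \<Rightarrow> nat \<Rightarrow> (nat \<Rightarrow> 'i set) \<Rightarrow> ('i \<Rightarrow> nat \<Rightarrow> 'h::complex_inner) \<Rightarrow> bool" where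
  "synthesis_well_defined e m \<sigma> f \<longleftrightarrow>
     (\<forall>c\<in>ell2_sum m \<sigma>. \<forall>j\<in>{1..m}. convergent (enum_sums e (\<sigma> j) (\<lambda>i. c i j *\<^sub>C f i j)))"

definition synthesis ::
  "(nat \<Rightarrow> 'i) \<Rightarrow> nat \<Rightarrow> (nat \<Rightarrow> 'i set) \<Rightarrow> ('i \<Rightarrow> nat \<Rightarrow> 'h::complex_inner)
    \<Rightarrow> ('i \<Rightarrow> nat \<Rightarrow> complex) \<Rightarrow> 'h" where
  "synthesis e m \<sigma> f c = (\<Sum>j\<in>{1..m}. lim (enum_sums e (\<sigma> j) (\<lambda>i. c i j *\<^sub>C f i j)))"

definition linear_on_ell2_sum ::
  "nat \<Rightarrow> (nat \<Rightarrow> 'i set) \<Rightarrow> (('i \<Rightarrow> nat \<Rightarrow> complex) \<Rightarrow> 'h::complex_inner) \<Rightarrow> bool" where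
  "linear_on_ell2_sum m \<sigma> T \<longleftrightarrow>
     (\<forall>c\<in>ell2_sum m \<sigma>. \<forall>d\<in>ell2_sum m \<sigma>. T (\<lambda>i j. c i j + d i j) = T c + T d) \<and>
     (\<forall>a. \<forall>c\<in>ell2_sum m \<sigma>. T (\<lambda>i j. a * c i j) = a *\<^sub>C T c)"

definition bounded_on_ell2_sum ::
  "nat \<Rightarrow> (nat \<Rightarrow> 'i set) \<Rightarrow> (('i \<Rightarrow> nat \<Rightarrow> complex) \<Rightarrow> 'h::complex_inner) \<Rightarrow> bool" where
  "bounded_on_ell2_sum m \<sigma> T \<longleftrightarrow>
     (\<exists>K::real. \<forall>c\<in>ell2_sum m \<sigma>. norm (T c) \<le> K * ell2_sum_norm m \<sigma> c)"

end

theory Submission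
  imports Defs
begin

text \<open>
  The synthesis operator of one piece is dual to the analysis map \<open>x \<mapsto> (cinner x (g i))\<^sub>i\<close>.
  Testing \<open>y = \<Sum>i\<in>F. c i *\<^sub>C g i\<close> against itself turns a Bessel bound \<open>B\<close> into
  \<open>norm y \<le> sqrt B * L2_set (cmod \<circ> c) F\<close> for all finite \<open>F\<close>, which makes the partial sums
  Cauchy and the operator bounded. Conversely, applying a bounded synthesis operator to the finitely
  supported coefficients \<open>c i = cinner x (g i)\<close> and pairing with \<open>x\<close> gives
  \<open>(\<Sum>i\<in>F. (cmod (c i))\<^sup>2) \<le> K\<^sup>2 * (norm x)\<^sup>2\<close>.
\<close>

section \<open>Finite sums in a complex inner product space\<close>

lemma scaleC_zero_left [simp]: "0 *\<^sub>C (x::'h::complex_inner) = 0"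
  using scaleR_eq_scaleC[of 0 x] by simp

lemma scaleC_sum_right:
  "a *\<^sub>C (\<Sum>i\<in>F. g i) = (\<Sum>i\<in>F. a *\<^sub>C (g i :: 'h::complex_inner))"
proof -
  have "a *\<^sub>C (0::'h) = 0"
    using scaleC_add_right[of a "0::'h" 0] by simp
  then show ?thesis
    by (induction F rule: infinite_finite_induct) (simp_all add: scaleC_add_right)
qed

lemma cinner_sum_left:
  "cinner (\<Sum>i\<in>F. g i) (y::'h::complex_inner) = (\<Sum>i\<in>F. cinner (g i) y)"
proof -
  have "cinner 0 y = 0"
    using cinner_add_left[of "0::'h" 0 y] by simp
  then show ?thesis
    by (induction F rule: infinite_finite_induct) (simp_all add: cinner_add_left)
qed

text \<open>The conjugated form exposes the coefficient \<open>cinner y (g i)\<close>, as both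
  directions require: it is paired with \<open>c\<close> by Cauchy-Schwarz, or \<open>c i\<close> is
  chosen equal to it, so that each term becomes a squared modulus.\<close>

lemma inner_sum_scaleC:
  fixes g :: "'i \<Rightarrow> 'h::complex_inner"
  shows "inner (\<Sum>i\<in>F. c i *\<^sub>C g i) y = (\<Sum>i\<in>F. Re (c i * cnj (cinner y (g i))))"
proof -
  have "c i * cinner (g i) y = c i * cnj (cinner y (g i))" for i
    by (metis cinner_commute)
  then show ?thesis
    by (simp only: inner_eq_Re_cinner cinner_sum_left cinner_scaleC_left Re_sum)
qed

lemma norm_scaleC: "norm (a *\<^sub>C (x::'h::complex_inner)) = cmod a * norm x"
proof -
  have "cinner x (a *\<^sub>C x) = cnj a * cinner x x"
    by (metis cinner_commute cinner_scaleC_left complex_cnj_mult)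
  then have "cinner (a *\<^sub>C x) (a *\<^sub>C x) = complex_of_real ((cmod a)\<^sup>2) * cinner x x"
    by (simp only: cinner_scaleC_left complex_norm_square mult.assoc)
  then have "Re (cinner (a *\<^sub>C x) (a *\<^sub>C x)) = (cmod a)\<^sup>2 * Re (cinner x x)"
    by simp
  then show ?thesis
    by (simp add: norm_eq_sqrt_Re_cinner[of x] norm_eq_sqrt_Re_cinner[of "a *\<^sub>C x"] real_sqrt_mult)
qed

text \<open>Lets a complex scalar pass through the limit of the partial sums.\<close>

lemma bounded_linear_scaleC: "bounded_linear (\<lambda>x::'h::complex_inner. a *\<^sub>C x)"
proof (rule bounded_linear_intro[of _ "cmod a"])
  fix r :: real and x :: 'h
  show "a *\<^sub>C (r *\<^sub>R x) = r *\<^sub>R (a *\<^sub>C x)"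
    by (simp add: scaleR_eq_scaleC scaleC_scaleC mult.commute)
qed (simp_all add: scaleC_add_right norm_scaleC mult.commute)

text \<open>The bound is assumed on the one set \<open>F\<close>, so that the estimate can be
  applied to each block of terms between two partial sums.\<close>

lemma norm_sum_scaleC_le:
  fixes g :: "'i \<Rightarrow> 'h::complex_inner"
  assumes "0 \<le> B" and bound: "\<And>x. (\<Sum>i\<in>F. (cmod (cinner x (g i)))\<^sup>2) \<le> B * (norm x)\<^sup>2"
  shows "norm (\<Sum>i\<in>F. c i *\<^sub>C g i) \<le> sqrt B * L2_set (\<lambda>i. cmod (c i)) F"
proof -
  define y where "y = (\<Sum>i\<in>F. c i *\<^sub>C g i)"
  have "(norm y)\<^sup>2 = (\<Sum>i\<in>F. Re (c i * cnj (cinner y (g i))))"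
    by (metis y_def inner_sum_scaleC power2_norm_eq_inner)
  also have "\<dots> \<le> (\<Sum>i\<in>F. \<bar>cmod (c i)\<bar> * \<bar>cmod (cinner y (g i))\<bar>)"
    by (intro sum_mono order_trans[OF complex_Re_le_cmod]) (simp add: norm_mult)
  also have "\<dots> \<le> L2_set (\<lambda>i. cmod (c i)) F * L2_set (\<lambda>i. cmod (cinner y (g i))) F"
    by (rule L2_set_mult_ineq)
  also have "\<dots> \<le> L2_set (\<lambda>i. cmod (c i)) F * (sqrt B * norm y)"
  proof (rule mult_left_mono)
    have "L2_set (\<lambda>i. cmod (cinner y (g i))) F \<le> sqrt (B * (norm y)\<^sup>2)"
      unfolding L2_set_def by (intro real_sqrt_le_mono bound)
    then show "L2_set (\<lambda>i. cmod (cinner y (g i))) F \<le> sqrt B * norm y"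
      by (simp add: real_sqrt_mult)
  qed simp
  finally have "norm y * norm y \<le> (sqrt B * L2_set (\<lambda>i. cmod (c i)) F) * norm y"
    by (simp add: power2_eq_square mult_ac)
  moreover have "0 \<le> sqrt B * L2_set (\<lambda>i. cmod (c i)) F"
    using \<open>0 \<le> B\<close> by simp
  ultimately show ?thesis
    \<comment> \<open>One factor \<open>norm y\<close> is cancelled; for \<open>y = 0\<close> the
      claim is the nonnegativity of the right-hand side.\<close>
    unfolding y_def[symmetric] by (cases "y = 0") auto
qed

section \<open>The Bessel condition in terms of finite subsets\<close>

lemma bessel_sequenceE:
  fixes g :: "'i \<Rightarrow> 'h::complex_inner"
  assumes "bessel_sequence S g"
  obtains B where "0 \<le> B"
    "\<And>F x. finite F \<Longrightarrow> F \<subseteq> S \<Longrightarrow> (\<Sum>i\<in>F. (cmod (cinner x (g i)))\<^sup>2) \<le> B * (norm x)\<^sup>2"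
proof -
  obtain B where B: "\<And>x. (\<lambda>i. (cmod (cinner x (g i)))\<^sup>2) summable_on S"
      "\<And>x. (\<Sum>\<^sub>\<infinity>i\<in>S. (cmod (cinner x (g i)))\<^sup>2) \<le> B * (norm x)\<^sup>2"
    using assms unfolding bessel_sequence_def by blast
  show thesis
  \<comment> \<open>The definition puts no sign on \<open>B\<close>; passing to the absolute value
    makes \<open>sqrt B\<close> a nonnegative constant later.\<close>
  proof (rule that[of "\<bar>B\<bar>"])
    fix F x assume "finite F" "F \<subseteq> S"
    then have "(\<Sum>i\<in>F. (cmod (cinner x (g i)))\<^sup>2) \<le> (\<Sum>\<^sub>\<infinity>i\<in>S. (cmod (cinner x (g i)))\<^sup>2)"
      using B(1) by (intro finite_sum_le_infsum) auto
    also have "\<dots> \<le> B * (norm x)\<^sup>2" by (rule B(2))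
    also have "\<dots> \<le> \<bar>B\<bar> * (norm x)\<^sup>2" by (intro mult_right_mono) auto
    finally show "(\<Sum>i\<in>F. (cmod (cinner x (g i)))\<^sup>2) \<le> \<bar>B\<bar> * (norm x)\<^sup>2" .
  qed simp
qed

text \<open>The terms are nonnegative, so a uniform bound on the finite sums gives summability and
  bounds the infinite sum as well.\<close>

lemma bessel_sequenceI:
  fixes g :: "'i \<Rightarrow> 'h::complex_inner"
  assumes "\<And>F x. finite F \<Longrightarrow> F \<subseteq> S \<Longrightarrow> (\<Sum>i\<in>F. (cmod (cinner x (g i)))\<^sup>2) \<le> B * (norm x)\<^sup>2"
  shows "bessel_sequence S g"
  unfolding bessel_sequence_def
proof (intro exI allI conjI)
  fix x
  show summable: "(\<lambda>i. (cmod (cinner x (g i)))\<^sup>2) summable_on S"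
    using assms by (intro nonneg_bdd_above_summable_on bdd_aboveI[of _ "B * (norm x)\<^sup>2"]) auto
  show "(\<Sum>\<^sub>\<infinity>i\<in>S. (cmod (cinner x (g i)))\<^sup>2) \<le> B * (norm x)\<^sup>2"
    using assms by (intro infsum_le_finite_sums[OF summable]) auto
qed

section \<open>Convergence of the partial sums along an enumeration\<close>

lemma enum_sums_diff:
  assumes "M \<le> N"
  shows "enum_sums e S g N - enum_sums e S g M = (\<Sum>i\<in>S \<inter> (e ` {..<N} - e ` {..<M}). g i)"
proof -
  have "S \<inter> e ` {..<M} \<subseteq> S \<inter> e ` {..<N}" using assms by fastforce
  then show ?thesis
    unfolding enum_sums_def by (simp add: sum_diff[symmetric] Diff_Int_distrib)
qed

text \<open>The real sums \<open>?b\<close> are increasing and bounded, hence Cauchy, and their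
  increments control those of the vector sums \<open>?s\<close>. Completeness then gives the limit,
  which inherits the bound on the partial sums.\<close>

lemma convergent_synthesis_piece:
  fixes g :: "'i \<Rightarrow> 'h::chilbert_space"
  assumes c: "c \<in> ell2 S" and "0 \<le> B"
    and bound: "\<And>F x. finite F \<Longrightarrow> F \<subseteq> S \<Longrightarrow> (\<Sum>i\<in>F. (cmod (cinner x (g i)))\<^sup>2) \<le> B * (norm x)\<^sup>2"
  shows "convergent (enum_sums e S (\<lambda>i. c i *\<^sub>C g i))"
    and "norm (lim (enum_sums e S (\<lambda>i. c i *\<^sub>C g i))) \<le> sqrt B * sqrt (\<Sum>\<^sub>\<infinity>i\<in>S. (cmod (c i))\<^sup>2)"
proof -
  let ?s = "enum_sums e S (\<lambda>i. c i *\<^sub>C g i)"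
  let ?b = "enum_sums e S (\<lambda>i. (cmod (c i))\<^sup>2)"
  have summable: "(\<lambda>i. (cmod (c i))\<^sup>2) summable_on S"
    using c by (simp add: ell2_def)
  have b_le: "?b N \<le> (\<Sum>\<^sub>\<infinity>i\<in>S. (cmod (c i))\<^sup>2)" for N
    unfolding enum_sums_def by (intro finite_sum_le_infsum summable) auto
  have "incseq ?b"
    unfolding incseq_def enum_sums_def by (intro allI impI sum_mono2) force+
  then have "Cauchy ?b"
    by (metis b_le incseq_convergent convergentI convergent_Cauchy)
  \<comment> \<open>Both increments are sums over the same block of newly enumerated indices, so the
    finite estimate applies with that block as \<open>F\<close>.\<close>
  have diff: "norm (?s N - ?s M) \<le> sqrt (B * (?b N - ?b M))" if "M \<le> N" for M N
    unfolding enum_sums_diff[OF that] real_sqrt_mult L2_set_def[symmetric]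
    by (intro norm_sum_scaleC_le bound \<open>0 \<le> B\<close>) auto
  have "Cauchy ?s"
    unfolding Cauchy_altdef2
  proof (intro allI impI)
    fix \<epsilon> :: real assume "0 < \<epsilon>"
    \<comment> \<open>Dividing by \<open>B + 1\<close> rather than \<open>B\<close> covers the case
      \<open>B = 0\<close>.\<close>
    then have "0 < \<epsilon>\<^sup>2 / (B + 1)" using \<open>0 \<le> B\<close> by simp
    then obtain M where M: "\<And>N. N \<ge> M \<Longrightarrow> dist (?b N) (?b M) < \<epsilon>\<^sup>2 / (B + 1)"
      using \<open>Cauchy ?b\<close> unfolding Cauchy_altdef2 by blast
    have "dist (?s N) (?s M) < \<epsilon>" if "N \<ge> M" for N
    proof -
      have le: "?b M \<le> ?b N" using \<open>incseq ?b\<close> that by (simp add: incseq_def)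
      then have "(B + 1) * (?b N - ?b M) < \<epsilon>\<^sup>2"
        using M[OF that] \<open>0 \<le> B\<close> by (simp add: dist_real_def field_simps)
      then have "B * (?b N - ?b M) < \<epsilon>\<^sup>2"
        using le by (simp add: algebra_simps)
      then have "sqrt (B * (?b N - ?b M)) < \<epsilon>"
        using \<open>0 < \<epsilon>\<close> by (metis real_less_lsqrt less_imp_le)
      then show ?thesis using diff[OF that] by (simp add: dist_norm)
    qed
    then show "\<exists>M. \<forall>N\<ge>M. dist (?s N) (?s M) < \<epsilon>" by blast
  qed
  then show conv: "convergent ?s" by (rule Cauchy_convergent)
  have "norm (?s N) \<le> sqrt (B * (\<Sum>\<^sub>\<infinity>i\<in>S. (cmod (c i))\<^sup>2))" for N
  proof -
    \<comment> \<open>The partial sums at 0 are empty, so the block starting there is the whole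
      partial sum.\<close>
    have "norm (?s N) \<le> sqrt (B * ?b N)"
      using diff[of 0 N] by (simp add: enum_sums_def)
    also have "\<dots> \<le> sqrt (B * (\<Sum>\<^sub>\<infinity>i\<in>S. (cmod (c i))\<^sup>2))"
      using b_le \<open>0 \<le> B\<close> by (intro real_sqrt_le_mono mult_left_mono)
    finally show ?thesis .
  qed
  then have "norm (lim ?s) \<le> sqrt (B * (\<Sum>\<^sub>\<infinity>i\<in>S. (cmod (c i))\<^sup>2))"
    using conv by (intro Lim_norm_ubound[of sequentially ?s]) (auto simp: convergent_LIMSEQ_iff)
  then show "norm (lim ?s) \<le> sqrt B * sqrt (\<Sum>\<^sub>\<infinity>i\<in>S. (cmod (c i))\<^sup>2)"
    by (simp add: real_sqrt_mult)
qed

section \<open>The norm of the direct sum and linearity of synthesis\<close>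

lemma ell2_sum_norm_eq:
  "ell2_sum_norm m \<sigma> c = sqrt (\<Sum>j\<in>{1..m}. \<Sum>\<^sub>\<infinity>i\<in>\<sigma> j. (cmod (c i j))\<^sup>2)"
proof -
  \<comment> \<open>This includes divergent series: complex summability passes back to the reals
    through \<open>Re\<close>, so both infinite sums take the default value 0 together.\<close>
  have "(\<Sum>\<^sub>\<infinity>i\<in>\<sigma> j. c i j * cnj (c i j)) = complex_of_real (\<Sum>\<^sub>\<infinity>i\<in>\<sigma> j. (cmod (c i j))\<^sup>2)" for j
    unfolding complex_norm_square[symmetric]
    by (intro infsum_bounded_linear_strong[where h = complex_of_real] bounded_linear_of_real)
      (auto simp del: of_real_power intro: summable_on_of_real
        dest: summable_on_bounded_linear[OF bounded_linear_Re])
  then show ?thesis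
    by (simp add: ell2_sum_norm_def ell2_sum_inner_def)
qed

text \<open>The partial sums are linear in the coefficients. Well-definedness ensures that each
  \<open>lim\<close> is a genuine limit, so linearity passes to it.\<close>

lemma linear_on_ell2_sum_synthesis:
  fixes f :: "'i \<Rightarrow> nat \<Rightarrow> 'h::complex_inner"
  assumes "synthesis_well_defined e m \<sigma> f"
  shows "linear_on_ell2_sum m \<sigma> (synthesis e m \<sigma> f)"
proof -
  let ?s = "\<lambda>c j. enum_sums e (\<sigma> j) (\<lambda>i. c i j *\<^sub>C f i j)"
  have conv: "?s c j \<longlonglongrightarrow> lim (?s c j)" if "c \<in> ell2_sum m \<sigma>" "j \<in> {1..m}" for c j
    using assms that by (simp add: synthesis_well_defined_def convergent_LIMSEQ_iff)
  have "lim (?s (\<lambda>i j. c i j + d i j) j) = lim (?s c j) + lim (?s d j)"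
    if "c \<in> ell2_sum m \<sigma>" "d \<in> ell2_sum m \<sigma>" "j \<in> {1..m}" for c d j
  proof -
    have "?s (\<lambda>i j. c i j + d i j) j = (\<lambda>N. ?s c j N + ?s d j N)"
      by (simp add: enum_sums_def scaleC_add_left sum.distrib fun_eq_iff)
    then show ?thesis
      using tendsto_add[OF conv[OF that(1,3)] conv[OF that(2,3)]] by (simp add: limI)
  qed
  moreover have "lim (?s (\<lambda>i j. a * c i j) j) = a *\<^sub>C lim (?s c j)"
    if "c \<in> ell2_sum m \<sigma>" "j \<in> {1..m}" for a c j
  proof -
    have "?s (\<lambda>i j. a * c i j) j = (\<lambda>N. a *\<^sub>C ?s c j N)"
      by (simp add: enum_sums_def scaleC_scaleC scaleC_sum_right fun_eq_iff)
    then show ?thesis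
      using bounded_linear.tendsto[OF bounded_linear_scaleC conv[OF that]] by (simp add: limI)
  qed
  ultimately show ?thesis
    unfolding linear_on_ell2_sum_def synthesis_def
    by (simp add: sum.distrib scaleC_sum_right)
qed

section \<open>From bounded synthesis to Bessel bounds\<close>

lemma eventually_subset_enumeration:
  assumes "enumeration e I" "finite F" "F \<subseteq> I"
  shows "\<forall>\<^sub>F N in sequentially. F \<subseteq> e ` {..<N}"
proof -
  have "F \<subseteq> range e"
    using assms unfolding enumeration_def bij_betw_def by (metis image_mono subset_UNIV order_trans)
  then obtain G where G: "finite G" "F = e ` G"
    using assms(2) by (metis finite_subset_image)
  then obtain k where "G \<subseteq> {..<k}"
    using finite_nat_iff_bounded by blast
  then have "F \<subseteq> e ` {..<N}" if "N \<ge> k" for N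
    using G that by fastforce
  then show ?thesis
    unfolding eventually_sequentially by blast
qed

text \<open>The partial sums are constant as soon as all of \<open>F\<close> has been
  enumerated.\<close>

lemma lim_enum_sums_finite_support:
  assumes "enumeration e I" "finite F" "F \<subseteq> S" "S \<subseteq> I" "\<And>i. i \<notin> F \<Longrightarrow> g i = 0"
  shows "lim (enum_sums e S g) = (\<Sum>i\<in>F. g i)"
proof (rule limI, rule tendsto_eventually)
  have "\<forall>\<^sub>F N in sequentially. F \<subseteq> e ` {..<N}"
    using assms by (intro eventually_subset_enumeration[OF assms(1)]) auto
  then show "\<forall>\<^sub>F N in sequentially. enum_sums e S g N = (\<Sum>i\<in>F. g i)"
  proof eventually_elim
    case (elim N)
    then show ?case
      unfolding enum_sums_def using assms by (intro sum.mono_neutral_right) auto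
  qed
qed

lemma bessel_sequence_of_bounded_synthesis:
  fixes f :: "'i \<Rightarrow> nat \<Rightarrow> 'h::complex_inner"
  assumes e: "enumeration e I" and sub: "\<sigma> j \<subseteq> I" and j: "j \<in> {1..m}"
    and bounded: "bounded_on_ell2_sum m \<sigma> (synthesis e m \<sigma> f)"
  shows "bessel_sequence (\<sigma> j) (\<lambda>i. f i j)"
proof -
  obtain K where K: "\<And>c. c \<in> ell2_sum m \<sigma> \<Longrightarrow> norm (synthesis e m \<sigma> f c) \<le> K * ell2_sum_norm m \<sigma> c"
    using bounded unfolding bounded_on_ell2_sum_def by blast
  show ?thesis
  proof (rule bessel_sequenceI[where B = "K\<^sup>2"])
    fix F x assume F: "finite F" "F \<subseteq> \<sigma> j"
    \<comment> \<open>All other summands are set to 0, so that the norm of \<open>c\<close> and its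
      synthesis see only the piece \<open>\<sigma> j\<close>.\<close>
    define c where "c i k = (if k = j \<and> i \<in> F then cinner x (f i j) else 0)" for i k
    \<comment> \<open>The number \<open>s\<close> is both the squared norm of \<open>c\<close> and
      the pairing of its synthesis with \<open>x\<close>; boundedness therefore yields
      \<open>s \<le> K * sqrt s * norm x\<close>.\<close>
    define s where "s = (\<Sum>i\<in>F. (cmod (cinner x (f i j)))\<^sup>2)"
    have "0 \<le> s" unfolding s_def by (simp add: sum_nonneg)
    have infsum_c: "((\<lambda>i. (cmod (c i k))\<^sup>2) has_sum (if k = j then s else 0)) (\<sigma> k)" for k
    proof (cases "k = j")
      case True
      have "((\<lambda>i. (cmod (c i j))\<^sup>2) has_sum (\<Sum>i\<in>F. (cmod (c i j))\<^sup>2)) (\<sigma> j)"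
        using F by (intro has_sum_finite_neutralI) (auto simp: c_def)
      then show ?thesis using True by (simp add: c_def s_def)
    qed (simp add: c_def)
    then have mem: "c \<in> ell2_sum m \<sigma>"
      using F j unfolding ell2_sum_def ell2_def by (auto simp: c_def summable_on_def)
    have norm_c: "ell2_sum_norm m \<sigma> c = sqrt s"
      using j by (simp add: ell2_sum_norm_eq infsumI[OF infsum_c])
    have lim_c: "lim (enum_sums e (\<sigma> k) (\<lambda>i. c i k *\<^sub>C f i k))
        = (if k = j then \<Sum>i\<in>F. cinner x (f i j) *\<^sub>C f i j else 0)" for k
    proof (cases "k = j")
      case True
      have "lim (enum_sums e (\<sigma> j) (\<lambda>i. c i j *\<^sub>C f i j)) = (\<Sum>i\<in>F. c i j *\<^sub>C f i j)"
        using F sub by (intro lim_enum_sums_finite_support[OF e]) (auto simp: c_def)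
      then show ?thesis using True by (simp add: c_def)
    next
      case False
      then have "enum_sums e (\<sigma> k) (\<lambda>i. c i k *\<^sub>C f i k) = (\<lambda>N. 0)"
        by (simp add: c_def enum_sums_def fun_eq_iff)
      then show ?thesis using False by (simp add: limI)
    qed
    then have T_c: "synthesis e m \<sigma> f c = (\<Sum>i\<in>F. cinner x (f i j) *\<^sub>C f i j)"
      using j by (simp add: synthesis_def)
    have "s = inner (synthesis e m \<sigma> f c) x"
      unfolding T_c inner_sum_scaleC s_def
      by (simp only: complex_norm_square[symmetric] Re_complex_of_real)
    also have "\<dots> \<le> norm (synthesis e m \<sigma> f c) * norm x"
      by (rule norm_cauchy_schwarz)
    also have "\<dots> \<le> K * sqrt s * norm x"
      using K[OF mem] unfolding norm_c by (intro mult_right_mono) auto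
    finally have "sqrt s * sqrt s \<le> (K * norm x) * sqrt s"
      using \<open>0 \<le> s\<close> by (simp add: mult_ac)
    \<comment> \<open>Cancelling \<open>sqrt s\<close> requires \<open>s > 0\<close>; for
      \<open>s = 0\<close> the squared bound is trivial, whatever the sign of
      \<open>K\<close>.\<close>
    then have "s = 0 \<or> sqrt s \<le> K * norm x"
      using \<open>0 \<le> s\<close> mult_right_le_imp_le[of "sqrt s" "sqrt s" "K * norm x"] by force
    then have "s \<le> (K * norm x)\<^sup>2"
      using \<open>0 \<le> s\<close> by (auto intro: sqrt_le_D)
    then show "(\<Sum>i\<in>F. (cmod (cinner x (f i j)))\<^sup>2) \<le> K\<^sup>2 * (norm x)\<^sup>2"
      by (simp add: s_def power_mult_distrib)
  qed
qed

section \<open>From Bessel bounds to bounded synthesis\<close>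

lemma synthesis_of_bessel_sequences:
  fixes f :: "'i \<Rightarrow> nat \<Rightarrow> 'h::chilbert_space"
  assumes "\<And>j. j \<in> {1..m} \<Longrightarrow> bessel_sequence (\<sigma> j) (\<lambda>i. f i j)"
  shows "synthesis_well_defined e m \<sigma> f"
    and "bounded_on_ell2_sum m \<sigma> (synthesis e m \<sigma> f)"
proof -
  have "\<forall>j\<in>{1..m}. \<exists>B. 0 \<le> B \<and> (\<forall>F x. finite F \<longrightarrow> F \<subseteq> \<sigma> j \<longrightarrow>
      (\<Sum>i\<in>F. (cmod (cinner x (f i j)))\<^sup>2) \<le> B * (norm x)\<^sup>2)"
    using assms bessel_sequenceE by metis
  then obtain B where B: "\<And>j. j \<in> {1..m} \<Longrightarrow> 0 \<le> B j"
    "\<And>j F x. \<lbrakk>j \<in> {1..m}; finite F; F \<subseteq> \<sigma> j\<rbrakk> \<Longrightarrow>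
      (\<Sum>i\<in>F. (cmod (cinner x (f i j)))\<^sup>2) \<le> B j * (norm x)\<^sup>2"
    by metis
  have mem: "(\<lambda>i. c i j) \<in> ell2 (\<sigma> j)" if "c \<in> ell2_sum m \<sigma>" "j \<in> {1..m}" for c j
    using that by (simp add: ell2_sum_def)
  note piece = convergent_synthesis_piece[OF mem B]
  show "synthesis_well_defined e m \<sigma> f"
    unfolding synthesis_well_defined_def using piece(1) by blast
  show "bounded_on_ell2_sum m \<sigma> (synthesis e m \<sigma> f)"
    unfolding bounded_on_ell2_sum_def
  proof (intro exI ballI)
    fix c assume c: "c \<in> ell2_sum m \<sigma>"
    \<comment> \<open>The triangle inequality over the \<open>m\<close> pieces, together with the
      fact that each component has norm at most that of \<open>c\<close>, gives the constant
      \<open>\<Sum>j\<in>{1..m}. sqrt (B j)\<close>.\<close>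
    have "norm (synthesis e m \<sigma> f c) \<le> (\<Sum>j\<in>{1..m}. sqrt (B j) * ell2_sum_norm m \<sigma> c)"
      unfolding synthesis_def
    proof (rule sum_norm_le)
      fix j assume j: "j \<in> {1..m}"
      have "(\<Sum>\<^sub>\<infinity>i\<in>\<sigma> j. (cmod (c i j))\<^sup>2) \<le> (\<Sum>j\<in>{1..m}. \<Sum>\<^sub>\<infinity>i\<in>\<sigma> j. (cmod (c i j))\<^sup>2)"
        using j by (intro member_le_sum infsum_nonneg) auto
      then have "sqrt (B j) * sqrt (\<Sum>\<^sub>\<infinity>i\<in>\<sigma> j. (cmod (c i j))\<^sup>2) \<le> sqrt (B j) * ell2_sum_norm m \<sigma> c"
        unfolding ell2_sum_norm_eq using B(1)[OF j]
        by (intro mult_left_mono real_sqrt_le_mono) auto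
      with piece(2)[OF c j j j]
      show "norm (lim (enum_sums e (\<sigma> j) (\<lambda>i. c i j *\<^sub>C f i j))) \<le> sqrt (B j) * ell2_sum_norm m \<sigma> c"
        by (meson order_trans)
    qed
    then show "norm (synthesis e m \<sigma> f c) \<le> (\<Sum>j\<in>{1..m}. sqrt (B j)) * ell2_sum_norm m \<sigma> c"
      by (simp add: sum_distrib_right)
  qed
qed

text \<open>Both implications hold for each partition separately; the constants may depend on the
  partition.\<close>

theorem theorem3p1:
  fixes f :: "'i \<Rightarrow> nat \<Rightarrow> 'h::chilbert_space"
    and I :: "'i set" and e :: "nat \<Rightarrow> 'i" and m :: nat
  assumes "separable_space (euclidean :: 'h topology)"
    and "countable I"
    and "enumeration e I"
  shows "bessel_woven m I f \<longleftrightarrow>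
    (\<forall>\<sigma>. partition_of m I \<sigma> \<longrightarrow>
       synthesis_well_defined e m \<sigma> f \<and>
       linear_on_ell2_sum m \<sigma> (synthesis e m \<sigma> f) \<and>
       bounded_on_ell2_sum m \<sigma> (synthesis e m \<sigma> f))"
proof (intro iffI allI impI)
  fix \<sigma> assume "bessel_woven m I f" "partition_of m I \<sigma>"
  then have "bessel_sequence (\<sigma> j) (\<lambda>i. f i j)" if "j \<in> {1..m}" for j
    using that by (simp add: bessel_woven_def)
  then show "synthesis_well_defined e m \<sigma> f \<and> linear_on_ell2_sum m \<sigma> (synthesis e m \<sigma> f) \<and>
      bounded_on_ell2_sum m \<sigma> (synthesis e m \<sigma> f)"
    by (intro conjI synthesis_of_bessel_sequences linear_on_ell2_sum_synthesis)
next
  assume synthesis: "\<forall>\<sigma>. partition_of m I \<sigma> \<longrightarrow>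
    synthesis_well_defined e m \<sigma> f \<and> linear_on_ell2_sum m \<sigma> (synthesis e m \<sigma> f) \<and>
    bounded_on_ell2_sum m \<sigma> (synthesis e m \<sigma> f)"
  show "bessel_woven m I f"
    unfolding bessel_woven_def
  proof (intro allI impI ballI)
    fix \<sigma> j assume \<sigma>: "partition_of m I \<sigma>" and j: "j \<in> {1..m}"
    \<comment> \<open>The inclusion guarantees that the enumeration reaches every index of a finite
      test set in \<open>\<sigma> j\<close>.\<close>
    then have "\<sigma> j \<subseteq> I" by (auto simp: partition_of_def)
    with \<sigma> j synthesis show "bessel_sequence (\<sigma> j) (\<lambda>i. f i j)"
      by (metis bessel_sequence_of_bounded_synthesis[OF assms(3)])
  qed
qed

end
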